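(* Let $(A,+,\circ)$ be a strongly nilpotent brace of nilpotency index $k$ and cardinality $p^n$, where $p$ is a prime with $k<p$ and $n+1<p$. Let $(A,+,\odot)$ be the pre-Lie ring associated to this brace. Then $(A,\circ)$ is the group of flows of the pre-Lie ring $(A,+,\odot)$; that is, $a\circ b=a+e^{L_{\Omega(a)}}(b)$ for all $a,b\in A$, where $L$, $e^{L}$ and $\Omega$ are computed with respect to the product $\odot$.
   Context: A (left) brace is a set $A$ with binary operations $+,\circ$ such that $(A,+)$ is an abelian group, $(A,\circ)$ is a group, and $a\circ(b+c)+a=a\circ b+a\circ c$ for all $a,b,c$. Write $a*b=a\circ b-a-b$. For additive subgroups $X,Y$, $X*Y$ is the additive subgroup generated by all $x*y$. Set $A^{[1]}=A$, $A^{[i+1]}=\sum_{j=1}^{i}A^{[j]}*A^{[i+1-j]}$; strongly nilpotent means $A^{[m]}=0$ for some $m$, nilpotency index $k$ means $A^{[k]}=0\neq A^{[k-1]}$. Associated pre-Lie ring: let $\gamma$ be a primitive root modulo $p^p$, $\xi=\gamma^{p^{p-1}}$, $a\cdot b=\sum_{i=0}^{p-2}\xi^{p-1-i}((\xi^i a)*b)$ (with $ma$ the $m$-fold additive multiple), and $a\odot b=-(1+p+\dots+p^{n-1})(a\cdot b)$; $(A,+,\odot)$ is a pre-Lie ring (abelian group with biadditive product satisfying $(x\odot y)\odot z-x\odot(y\odot z)=(y\odot x)\odot z-y\odot(x\odot z)$). Group of flows of a left nilpotent pre-Lie ring $(A,+,\odot)$ of order $p^n$: let $A^{\mathrm{id}}=A\times\mathbb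 Z$ with $(r,m)+(s,m')=(r+s,m+m')$, $(r,m)\odot(s,m')=(r\odot s+ms+m'r,mm')$; identify $A$ with $A\times\{0\}$, put $1=(0,1)$. For $a\in A$ let $L_a(x)=a\odot x$, $e^{L_a}(x)=\sum_{j\ge0}\frac1{j!}L_a^j(x)$ (finite sum; needed factorials invertible modulo $p^n$), $W(a)=e^{L_a}(1)-1$, a bijection of $A$ with inverse $\Omega$. *)

theory Defs
  imports Main "HOL-Number_Theory.Number_Theory" "HOL-Library.Product_Plus"
begin

definition is_group_op :: "('a \<Rightarrow> 'a \<Rightarrow> 'a) \<Rightarrow> bool" where
  "is_group_op f \<longleftrightarrow> (\<forall>a b c. f (f a b) c = f a (f b c)) \<and>
     (\<exists>e. (\<forall>a. f e a = a \<and> f a e = a) \<and> (\<forall>a. \<exists>b. f a b = e \<and> f b a = e))"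

definition is_brace :: "('a::ab_group_add \<Rightarrow> 'a \<Rightarrow> 'a) \<Rightarrow> bool" where
  "is_brace circ \<longleftrightarrow> is_group_op circ \<and>
     (\<forall>a b c. circ a (b + c) + a = circ a b + circ a c)"

definition bstar :: "('a::ab_group_add \<Rightarrow> 'a \<Rightarrow> 'a) \<Rightarrow> 'a \<Rightarrow> 'a \<Rightarrow> 'a" where
  "bstar circ a b = circ a b - a - b"

definition add_gen :: "'a::ab_group_add set \<Rightarrow> 'a set" where
  "add_gen S = \<Inter>{H. S \<subseteq> H \<and> 0 \<in> H \<and> (\<forall>x\<in>H. \<forall>y\<in>H. x + y \<in> H) \<and> (\<forall>x\<in>H. - x \<in> H)}"

definition star_set :: "('a::ab_group_add \<Rightarrow> 'a \<Rightarrow> 'a) \<Rightarrow> 'a set \<Rightarrow> 'a set \<Rightarrow> 'a set" where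
  "star_set circ X Y = add_gen {bstar circ x y | x y. x \<in> X \<and> y \<in> Y}"

text \<open>A^[i]; A^[1] = A, A^[i+1] = sum_{j=1}^i A^[j] * A^[i+1-j] (the sum of additive
  subgroups is the subgroup generated by their union). Index 0 is set to A by convention.\<close>
function brace_pow :: "('a::ab_group_add \<Rightarrow> 'a \<Rightarrow> 'a) \<Rightarrow> nat \<Rightarrow> 'a set" where
  "brace_pow circ 0 = UNIV"
| "brace_pow circ (Suc 0) = UNIV"
| "brace_pow circ (Suc (Suc i)) =
     add_gen (\<Union>j\<in>{1..Suc i}. star_set circ (brace_pow circ j) (brace_pow circ (Suc (Suc i) - j)))"
  by pat_completeness auto
termination by (relation "measure (\<lambda>(c, i). i)") auto

definition strongly_nilpotent :: "('a::ab_group_add \<Rightarrow> 'a \<Rightarrow> 'a) \<Rightarrow> bool" where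
  "strongly_nilpotent circ \<longleftrightarrow> (\<exists>m. brace_pow circ m = {0})"

definition nilpotency_index :: "('a::ab_group_add \<Rightarrow> 'a \<Rightarrow> 'a) \<Rightarrow> nat \<Rightarrow> bool" where
  "nilpotency_index circ k \<longleftrightarrow> brace_pow circ k = {0} \<and> brace_pow circ (k - 1) \<noteq> {0}"

definition zsmul :: "int \<Rightarrow> 'a::ab_group_add \<Rightarrow> 'a" where
  "zsmul m a = (if 0 \<le> m then (\<Sum>_\<in>{..<nat m}. a) else - (\<Sum>_\<in>{..<nat (- m)}. a))"

text \<open>gamma is a primitive root modulo p^p, xi = gamma^(p^(p-1)).\<close>
definition preLie_dot :: "('a::ab_group_add \<Rightarrow> 'a \<Rightarrow> 'a) \<Rightarrow> nat \<Rightarrow> nat \<Rightarrow> 'a \<Rightarrow> 'a \<Rightarrow> 'a" where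
  "preLie_dot circ p \<gamma> a b =
     (let \<xi> = \<gamma> ^ (p ^ (p - 1)) in
      \<Sum>i\<in>{0..p-2}. zsmul (int (\<xi> ^ (p - 1 - i))) (bstar circ (zsmul (int (\<xi> ^ i)) a) b))"

definition preLie_odot :: "('a::ab_group_add \<Rightarrow> 'a \<Rightarrow> 'a) \<Rightarrow> nat \<Rightarrow> nat \<Rightarrow> nat \<Rightarrow> 'a \<Rightarrow> 'a \<Rightarrow> 'a" where
  "preLie_odot circ p n \<gamma> a b = zsmul (- int (\<Sum>i<n. p ^ i)) (preLie_dot circ p \<gamma> a b)"

text \<open>A^id = A \<times> Z, with A embedded as A \<times> {0} and 1 = (0,1).\<close>
definition id_odot :: "('a::ab_group_add \<Rightarrow> 'a \<Rightarrow> 'a) \<Rightarrow> 'a \<times> int \<Rightarrow> 'a \<times> int \<Rightarrow> 'a \<times> int" where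
  "id_odot od x y = (case x of (r, m) \<Rightarrow> case y of (s, m') \<Rightarrow>
      (od r s + zsmul m s + zsmul m' r, m * m'))"

definition L_op :: "('a::ab_group_add \<Rightarrow> 'a \<Rightarrow> 'a) \<Rightarrow> 'a \<Rightarrow> 'a \<times> int \<Rightarrow> 'a \<times> int" where
  "L_op od a x = id_odot od (a, 0) x"

definition inv_fact_mod :: "nat \<Rightarrow> nat \<Rightarrow> int" where
  "inv_fact_mod q j = (THE u. u \<in> {0..<int q} \<and> [u * int (fact j) = 1] (mod int q))"

definition id_scale :: "int \<Rightarrow> 'a::ab_group_add \<times> int \<Rightarrow> 'a \<times> int" where
  "id_scale c x = (case x of (r, m) \<Rightarrow> (zsmul c r, c * m))"

text \<open>e^{L_a}(x) = sum_{j \<ge> 0} (1/j!) L_a^j(x), a finite sum: j ranges below the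
  least N from which on all L_a^j(x) vanish. Here q = p^n is the order of A.\<close>
definition expL :: "('a::ab_group_add \<Rightarrow> 'a \<Rightarrow> 'a) \<Rightarrow> nat \<Rightarrow> 'a \<Rightarrow> 'a \<times> int \<Rightarrow> 'a \<times> int" where
  "expL od q a x =
     (\<Sum>j < (LEAST N. \<forall>i\<ge>N. (L_op od a ^^ i) x = 0).
        id_scale (inv_fact_mod q j) ((L_op od a ^^ j) x))"

definition flowW :: "('a::ab_group_add \<Rightarrow> 'a \<Rightarrow> 'a) \<Rightarrow> nat \<Rightarrow> 'a \<Rightarrow> 'a" where
  "flowW od q a = fst (expL od q a (0, 1) - (0, 1))"

definition flowOmega :: "('a::ab_group_add \<Rightarrow> 'a \<Rightarrow> 'a) \<Rightarrow> nat \<Rightarrow> 'a \<Rightarrow> 'a" where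
  "flowOmega od q = inv_into UNIV (flowW od q)"

end

theory Submission
  imports Defs
begin

text \<open>
  Write \<open>\<lambda>_x(b) = x \<circ> b - x\<close>. Fix \<open>x\<close>. Since \<open>k < p\<close>, the binomial theorem shows that both
  \<open>\<lambda>_x^m\<close> and the \<open>m\<close>-th power \<open>g(m)\<close> of \<open>x\<close> in \<open>(A, \<circ>)\<close> are polynomials in \<open>m\<close> of degree less
  than \<open>p - 1\<close>, and summing over the Teichmueller units \<open>\<xi>^i\<close> extracts their coefficients; in
  particular \<open>a \<odot> b\<close> is the coefficient of \<open>m\<close> in \<open>(m a) * b\<close>. Let \<open>a\<close> be the coefficient of \<open>m\<close>
  in \<open>g(m)\<close>. Writing \<open>m a = g(m) \<circ> r(m)\<close>, the curve \<open>r\<close> vanishes to second order, hence so does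
  \<open>\<lambda>_{r(m)} - 1\<close>, and therefore \<open>L_a\<close> is the coefficient of \<open>m\<close> in \<open>\<lambda>_x^m\<close>. Differentiating the
  laws \<open>\<lambda>_x^{l+m} = \<lambda>_x^l \<lambda>_x^m\<close> and \<open>g(l + m) = g(l) + \<lambda>_x^l(g(m))\<close> gives
  \<open>\<lambda>_x^m = e^{m L_a}\<close> and \<open>g(m) = (e^{m L_a} - 1)/L_a (a)\<close>. At \<open>m = 1\<close> this reads
  \<open>\<lambda>_x = e^{L_a}\<close> and \<open>x = W(a)\<close>; so \<open>W\<close> is onto, and bijective because \<open>A\<close> is finite.
\<close>

section \<open>Integer multiples\<close>

lemma zsmul_0_left [simp]: "zsmul 0 a = 0"
  by (simp add: zsmul_def)

lemma zsmul_succ: "zsmul (m + 1) a = zsmul m a + a"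
proof -
  consider "m \<ge> 0" | "m = -1" | "m < -1" by linarith
  then show ?thesis
  proof cases
    case 1
    then have "nat (m + 1) = Suc (nat m)" by simp
    with 1 show ?thesis by (simp add: zsmul_def)
  next
    case 2
    then show ?thesis by (simp add: zsmul_def)
  next
    case 3
    then have "nat (- m) = Suc (nat (- (m + 1)))" by linarith
    with 3 show ?thesis by (simp add: zsmul_def)
  qed
qed

lemma zsmul_1_left [simp]: "zsmul 1 a = a"
  using zsmul_succ[of 0 a] by simp

lemma zsmul_pred: "zsmul (m - 1) a = zsmul m a - a"
  using zsmul_succ[of "m - 1" a] by simp

lemma zsmul_add_left: "zsmul (l + m) a = zsmul l a + zsmul m a"
proof (induction m rule: int_induct[where k = 0])
  case (step1 m)
  then show ?case using zsmul_succ[of "l + m" a] zsmul_succ[of m a] by (simp add: algebra_simps)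
next
  case (step2 m)
  then show ?case using zsmul_pred[of "l + m" a] zsmul_pred[of m a] by (simp add: add_diff_eq)
qed simp

lemma zsmul_add_right: "zsmul m (a + b) = zsmul m a + zsmul m b"
  by (induction m rule: int_induct[where k = 0]) (simp_all add: zsmul_succ zsmul_pred)

lemma zsmul_minus_left: "zsmul (- m) a = - zsmul m a"
  using zsmul_add_left[of m "- m" a] by (simp add: add_eq_0_iff)

lemma zsmul_zsmul: "zsmul l (zsmul m a) = zsmul (l * m) a"
proof (induction l rule: int_induct[where k = 0])
  case (step2 l)
  then show ?case
    using zsmul_add_left[of "l * m - m" m a] by (simp add: zsmul_pred left_diff_distrib)
qed (simp_all add: zsmul_succ zsmul_add_left distrib_right)

interpretation zs: Modules.module zsmul
  by unfold_locales (simp_all add: zsmul_add_left zsmul_add_right zsmul_zsmul)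

lemma additive_zsmul:
  assumes "additive f"
  shows "f (zsmul m a) = zsmul m (f a)"
proof -
  interpret additive f by fact
  show ?thesis
    by (induction m rule: int_induct[where k = 0])
       (simp_all add: zsmul_succ zsmul_pred add diff zero)
qed

text \<open>Translation by \<open>a\<close> permutes the group, so the sum of all elements absorbs
  this multiple of \<open>a\<close>.\<close>

lemma zsmul_card_UNIV:
  fixes a :: "'a::ab_group_add"
  assumes "finite (UNIV :: 'a set)"
  shows "zsmul (int (card (UNIV :: 'a set))) a = 0"
proof -
  have const: "(\<Sum>x\<in>X. a) = zsmul (int (card X)) a" if "finite X" for X :: "'a set"
    using that by (induction X) (simp_all add: zsmul_add_left add.commute)
  have "(\<Sum>x\<in>UNIV. x) = (\<Sum>x\<in>UNIV. x + a)"
    by (rule sum.reindex_bij_witness[of _ "\<lambda>x. x + a" "\<lambda>x. x - a"]) auto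
  also have "\<dots> = (\<Sum>x\<in>UNIV. x) + (\<Sum>x\<in>(UNIV::'a set). a)"
    by (rule sum.distrib)
  finally show ?thesis using const[OF assms] by simp
qed

section \<open>Teichmueller units\<close>

text \<open>In \<open>y^p - 1 = (y - 1)(1 + y + \<dots> + y^(p-1))\<close> with \<open>y\<close>
  congruent to 1 modulo \<open>p\<close>, the second factor is divisible by \<open>p\<close>; so
  each \<open>p\<close>-th power gains one factor \<open>p\<close>.\<close>

lemma cong_1_power_prime_power:
  fixes x :: int
  assumes "[x = 1] (mod int p)"
  shows "[x ^ (p ^ t) = 1] (mod int p ^ Suc t)"
proof (induction t)
  case (Suc t)
  let ?y = "x ^ (p ^ t)"
  have "[?y = 1 ^ (p ^ t)] (mod int p)" by (intro cong_pow assms)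
  then have y: "[?y = 1] (mod int p)" by simp
  have "[(\<Sum>i<p. ?y ^ i) = (\<Sum>i<p. 1 ^ i)] (mod int p)"
    by (intro cong_sum cong_pow y)
  then have "int p dvd (\<Sum>i<p. ?y ^ i)" by (simp add: cong_def mod_eq_0_iff_dvd)
  moreover have "int p ^ Suc t dvd ?y - 1" using Suc by (simp add: cong_iff_dvd_diff)
  ultimately have "int p ^ Suc t * int p dvd (?y - 1) * (\<Sum>i<p. ?y ^ i)"
    by (rule mult_dvd_mono[rotated])
  moreover have "(?y - 1) * (\<Sum>i<p. ?y ^ i) = x ^ (p ^ Suc t) - 1"
    by (subst power_diff_1_eq[symmetric]) (simp add: power_mult[symmetric] mult.commute)
  ultimately show ?case by (simp add: cong_iff_dvd_diff mult.commute)
qed (use assms in simp)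

text \<open>\<open>\<gamma>\<close> has order \<open>p^(p-1) (p - 1)\<close>, so
  \<open>\<xi>\<close> has order \<open>p - 1\<close>. A relation modulo \<open>p\<close> lifts to
  \<open>p^p\<close> after raising to the power \<open>p^(p-1)\<close>, which is prime to
  \<open>p - 1\<close>.\<close>

lemma primroot_teichmuller:
  fixes p \<gamma> :: nat
  assumes "prime p" "residue_primroot (p ^ p) \<gamma>"
  defines "\<xi> \<equiv> \<gamma> ^ (p ^ (p - 1))"
  shows "[int \<xi> ^ (p - 1) = 1] (mod int p ^ p)"
    and "\<lbrakk>0 < i; i < p - 1\<rbrakk> \<Longrightarrow> \<not> [int \<xi> ^ i = 1] (mod int p)"
    and "coprime (int \<xi>) (int p)"
proof -
  have p0: "p > 0" using assms(1) prime_gt_0_nat by blast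
  have cop: "coprime (p ^ p) \<gamma>" and ord: "ord (p ^ p) \<gamma> = totient (p ^ p)"
    using assms(2) by (auto simp: residue_primroot_def)
  have tot: "totient (p ^ p) = p ^ (p - 1) * (p - 1)"
    using assms(1) p0 by (simp add: totient_prime_power)
  have dvd_iff: "[\<gamma> ^ d = 1] (mod (p ^ p)) \<longleftrightarrow> p ^ (p - 1) * (p - 1) dvd d" for d
    using ord_divides[of \<gamma> d "p ^ p"] ord tot by simp
  have "[\<xi> ^ (p - 1) = 1] (mod (p ^ p))"
    unfolding \<xi>_def power_mult[symmetric] dvd_iff by simp
  then show "[int \<xi> ^ (p - 1) = 1] (mod int p ^ p)"
    by (metis cong_int_iff of_nat_1 of_nat_power)
  show "coprime (int \<xi>) (int p)"
    using cop p0 by (simp add: \<xi>_def coprime_commute)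
  show "\<not> [int \<xi> ^ i = 1] (mod int p)" if i: "0 < i" "i < p - 1"
  proof
    assume "[int \<xi> ^ i = 1] (mod int p)"
    from cong_1_power_prime_power[OF this, of "p - 1"]
    have "[\<gamma> ^ (p ^ (p - 1) * i * p ^ (p - 1)) = 1] (mod (p ^ p))"
      using p0 by (simp add: \<xi>_def power_mult[symmetric] flip: cong_int_iff)
    then have "p ^ (p - 1) * (p - 1) dvd p ^ (p - 1) * (i * p ^ (p - 1))"
      unfolding dvd_iff by (simp only: mult.assoc)
    then have "p - 1 dvd i * p ^ (p - 1)" using p0 by simp
    moreover have "coprime (p - 1) (p ^ (p - 1))"
      using p0 coprime_diff_one_left_nat[of p] by (metis coprime_power_right_iff)
    ultimately have "p - 1 dvd i" by (simp add: coprime_dvd_mult_left_iff)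
    with i show False by (auto dest: dvd_imp_le)
  qed
qed

section \<open>The descending series of a brace\<close>

definition add_subgroup :: "'a::ab_group_add set \<Rightarrow> bool" where
  "add_subgroup H \<longleftrightarrow> 0 \<in> H \<and> (\<forall>x\<in>H. \<forall>y\<in>H. x + y \<in> H) \<and> (\<forall>x\<in>H. - x \<in> H)"

lemma add_subgroup_zero: "add_subgroup H \<Longrightarrow> 0 \<in> H"
  and add_subgroup_add: "add_subgroup H \<Longrightarrow> x \<in> H \<Longrightarrow> y \<in> H \<Longrightarrow> x + y \<in> H"
  and add_subgroup_minus: "add_subgroup H \<Longrightarrow> x \<in> H \<Longrightarrow> - x \<in> H"
  by (simp_all add: add_subgroup_def)

lemma add_subgroup_diff:
  assumes "add_subgroup H" "x \<in> H" "y \<in> H"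
  shows "x - y \<in> H"
  using add_subgroup_add[OF assms(1,2) add_subgroup_minus[OF assms(1,3)]] by simp

lemma add_subgroup_sum: "add_subgroup H \<Longrightarrow> (\<And>i. i \<in> I \<Longrightarrow> f i \<in> H) \<Longrightarrow> sum f I \<in> H"
  by (induction I rule: infinite_finite_induct) (auto intro: add_subgroup_zero add_subgroup_add)

lemma add_subgroup_zsmul: "add_subgroup H \<Longrightarrow> x \<in> H \<Longrightarrow> zsmul m x \<in> H"
  by (simp add: zsmul_def add_subgroup_sum add_subgroup_minus)

lemma add_gen_eq: "add_gen S = \<Inter>{H. S \<subseteq> H \<and> add_subgroup H}"
  by (simp add: add_gen_def add_subgroup_def)

lemma add_subgroup_add_gen: "add_subgroup (add_gen S)"
  unfolding add_gen_eq by (auto simp: add_subgroup_def)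

lemma add_gen_superset: "S \<subseteq> add_gen S"
  unfolding add_gen_eq by blast

lemma add_gen_least: "S \<subseteq> H \<Longrightarrow> add_subgroup H \<Longrightarrow> add_gen S \<subseteq> H"
  unfolding add_gen_eq by blast

lemma add_subgroup_brace_pow: "add_subgroup (brace_pow circ i)"
  by (cases "(circ, i)" rule: brace_pow.cases) (auto simp: add_subgroup_add_gen,
      simp_all add: add_subgroup_def)

lemma bstar_in_brace_pow_pos:
  assumes "x \<in> brace_pow circ i" "y \<in> brace_pow circ j" "1 \<le> i" "1 \<le> j"
  shows "bstar circ x y \<in> brace_pow circ (i + j)"
proof -
  obtain m where m: "i + j = Suc (Suc m)"
    using assms by (metis Suc_le_D One_nat_def add_Suc add_Suc_right)
  have "bstar circ x y \<in> star_set circ (brace_pow circ i) (brace_pow circ (Suc (Suc m) - i))"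
    unfolding star_set_def using assms m by (intro subsetD[OF add_gen_superset]) (auto simp flip: m)
  then show ?thesis
    unfolding m brace_pow.simps using assms m by (intro subsetD[OF add_gen_superset]) auto
qed

text \<open>In a generator \<open>bstar circ x y\<close> one index can be lowered and stay positive:
  that of \<open>y\<close> if \<open>j = 1\<close>, that of \<open>x\<close> otherwise.\<close>

lemma brace_pow_Suc_subset: "brace_pow circ (Suc i) \<subseteq> brace_pow circ i"
proof (induction i rule: less_induct)
  case (less i)
  show ?case
  proof (cases "i \<le> 1")
    case True
    then show ?thesis by (cases i) auto
  next
    case False
    then obtain m where m: "i = Suc (Suc m)" by (metis One_nat_def not_less_eq_eq not0_implies_Suc le0)
    have "bstar circ x y \<in> brace_pow circ i"
      if j: "1 \<le> j" "j \<le> i" and x: "x \<in> brace_pow circ j" and y: "y \<in> brace_pow circ (Suc i - j)" for j x y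
    proof (cases "j = 1")
      case True
      have "y \<in> brace_pow circ (i - 1)" using less[of "i - 1"] y True m by auto
      then show ?thesis using bstar_in_brace_pow_pos[OF x, of y "i - 1"] True m by auto
    next
      case False
      then have "x \<in> brace_pow circ (j - 1)" using less[of "j - 1"] x j by (cases j) auto
      then show ?thesis using bstar_in_brace_pow_pos[of x circ "j - 1" y "Suc i - j"] y j False by auto
    qed
    then have "star_set circ (brace_pow circ j) (brace_pow circ (Suc i - j)) \<subseteq> brace_pow circ i"
      if "j \<in> {1..i}" for j
      unfolding star_set_def using that
      by (intro add_gen_least add_subgroup_brace_pow) auto
    then have "add_gen (\<Union>j\<in>{1..i}. star_set circ (brace_pow circ j) (brace_pow circ (Suc i - j)))
        \<subseteq> brace_pow circ i"
      by (intro add_gen_least add_subgroup_brace_pow) blast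
    then show ?thesis using m by simp
  qed
qed

lemma brace_pow_antimono: "i \<le> j \<Longrightarrow> brace_pow circ j \<subseteq> brace_pow circ i"
  using lift_Suc_antimono_le[of "brace_pow circ", OF brace_pow_Suc_subset] by blast

lemma bstar_in_brace_pow:
  assumes "x \<in> brace_pow circ i" "y \<in> brace_pow circ j"
  shows "bstar circ x y \<in> brace_pow circ (i + j)"
proof -
  \<comment> \<open>Indices \<open>0\<close> and \<open>1\<close> both denote the whole
    brace.\<close>
  have "x \<in> brace_pow circ (max 1 i)" "y \<in> brace_pow circ (max 1 j)"
    using assms by (auto simp: max_def le_Suc_eq)
  then have "bstar circ x y \<in> brace_pow circ (max 1 i + max 1 j)"
    by (rule bstar_in_brace_pow_pos) auto
  then show ?thesis using brace_pow_antimono[OF add_mono[OF max.cobounded2[of i 1] max.cobounded2[of j 1]]] by blast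
qed

section \<open>Powers in the multiplicative group\<close>

lemma binomial_Suc_recurrence:
  "int (Suc j) * int (m choose Suc j) = int m * int (m choose j) - int j * int (m choose j)"
proof (cases "j < m")
  case True
  then obtain b where "m = Suc (j + b)" using less_iff_Suc_add by auto
  then show ?thesis using Suc_times_binomial_add[of j b]
    by (simp add: algebra_simps flip: of_nat_mult of_nat_add)
next
  case False
  then show ?thesis by (cases "j = m") (auto simp: binomial_eq_0)
qed

text \<open>Binomial theorem for \<open>(1 + N)^m\<close>, by Pascal's rule;
  \<open>N^k b = 0\<close> removes the top term at each step.\<close>

lemma funpow_one_plus_additive:
  assumes N: "additive N" and nil: "(N ^^ k) b = 0" and k: "k > 0"
  shows "((\<lambda>y. y + N y) ^^ m) b = (\<Sum>j<k. zsmul (int (m choose j)) ((N ^^ j) b))"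
proof -
  interpret additive N by fact
  obtain K where K: "k = Suc K" using k by (cases k) auto
  show ?thesis
  proof (induction m)
    case 0
    show ?case by (simp add: K sum.lessThan_Suc_shift del: sum.lessThan_Suc)
  next
    case (Suc m)
    let ?f = "\<lambda>j. zsmul (int (m choose j)) ((N ^^ j) b)"
    let ?g = "\<lambda>j. zsmul (int (m choose j)) ((N ^^ Suc j) b)"
    have "((\<lambda>y. y + N y) ^^ Suc m) b = (\<Sum>j<k. ?f j) + (\<Sum>j<k. ?g j)"
      by (simp add: Suc sum additive_zsmul[OF N])
    also have "(\<Sum>j<k. ?g j) = (\<Sum>j<K. ?g j)"
      using nil by (simp add: K)
    also have "(\<Sum>j<k. ?f j) = b + (\<Sum>j<K. ?f (Suc j))"
      by (simp add: K sum.lessThan_Suc_shift del: sum.lessThan_Suc)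
    also have "\<dots> + (\<Sum>j<K. ?g j) = b + (\<Sum>j<K. zsmul (int (Suc m choose Suc j)) ((N ^^ Suc j) b))"
      by (simp add: sum.distrib[symmetric] zsmul_add_left add_ac)
    also have "\<dots> = (\<Sum>j<k. zsmul (int (Suc m choose j)) ((N ^^ j) b))"
      by (simp add: K sum.lessThan_Suc_shift del: sum.lessThan_Suc binomial_Suc_Suc)
    finally show ?case .
  qed
qed

text \<open>The lambda map of a brace, an action of the multiplicative group on the additive
  one.\<close>

definition lam :: "('a::ab_group_add \<Rightarrow> 'a \<Rightarrow> 'a) \<Rightarrow> 'a \<Rightarrow> 'a \<Rightarrow> 'a" where
  "lam circ x b = circ x b - x"

lemma bstar_eq_lam: "bstar circ x b = lam circ x b - b"
  by (simp add: bstar_def lam_def)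

lemma lam_eq_bstar: "lam circ x b = b + bstar circ x b"
  by (simp add: bstar_def lam_def)

locale brace =
  fixes circ :: "'a::ab_group_add \<Rightarrow> 'a \<Rightarrow> 'a"
  assumes is_brace: "is_brace circ"
begin

lemma circ_assoc: "circ (circ a b) c = circ a (circ b c)"
  using is_brace by (simp add: is_brace_def is_group_op_def)

lemma circ_distrib: "circ a (b + c) + a = circ a b + circ a c"
  using is_brace by (simp add: is_brace_def)

lemma circ_0_right: "circ a 0 = a"
  using circ_distrib[of a 0 0] by simp

lemma circ_0_left: "circ 0 a = a"
  and circ_inverse_exists: "\<exists>b. circ a b = 0 \<and> circ b a = 0"
proof -
  obtain e where e: "\<And>a. circ e a = a" "\<And>a. \<exists>b. circ a b = e \<and> circ b a = e"
    using is_brace unfolding is_brace_def is_group_op_def by metis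
  have "e = 0" using e(1)[of 0] circ_0_right[of e] by simp
  with e show "circ 0 a = a" "\<exists>b. circ a b = 0 \<and> circ b a = 0" by auto
qed

lemma circ_eq: "circ x y = x + lam circ x y"
  by (simp add: lam_def)

lemma additive_lam: "additive (lam circ x)"
proof
  fix b c show "lam circ x (b + c) = lam circ x b + lam circ x c"
    using circ_distrib[of x b c] by (simp add: lam_def algebra_simps)
qed

lemma additive_lam_funpow: "additive (lam circ x ^^ m)"
  by (induction m) (auto simp: additive_def additive.add[OF additive_lam])

lemma additive_bstar: "additive (bstar circ x)"
  unfolding bstar_eq_lam[abs_def]
  by (auto simp: additive_def additive.add[OF additive_lam])

lemma lam_circ: "lam circ (circ x y) b = lam circ x (lam circ y b)"
proof -
  have "lam circ x (lam circ y b) = lam circ x (circ y b) - lam circ x y"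
    unfolding lam_def[of circ y] by (rule additive.diff[OF additive_lam])
  then show ?thesis by (simp add: lam_def circ_assoc)
qed

lemma lam_0: "lam circ 0 b = b"
  by (simp add: lam_def circ_0_left)

definition cpow :: "'a \<Rightarrow> nat \<Rightarrow> 'a" where
  "cpow x m = ((\<lambda>y. circ y x) ^^ m) 0"

lemma cpow_0: "cpow x 0 = 0" and cpow_Suc: "cpow x (Suc m) = circ (cpow x m) x"
  by (simp_all add: cpow_def)

lemma cpow_1: "cpow x 1 = x"
  by (simp add: cpow_def circ_0_left)

lemma lam_cpow: "lam circ (cpow x m) = lam circ x ^^ m"
proof (induction m)
  case (Suc m)
  then show ?case
    by (intro ext) (simp add: cpow_Suc lam_circ funpow_swap1)
qed (simp add: cpow_0 lam_0 fun_eq_iff)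

lemma cpow_add: "cpow x (l + m) = circ (cpow x l) (cpow x m)"
  by (induction m) (simp_all add: cpow_0 cpow_Suc circ_0_right circ_assoc)

text \<open>Consecutive powers differ by \<open>\<lambda>_x^m(x)\<close>; summing its binomial
  expansion raises each lower index to \<open>Suc j\<close>.\<close>

lemma cpow_eq_sum:
  assumes "(bstar circ x ^^ k) x = 0" "k > 0"
  shows "cpow x m = (\<Sum>j<k. zsmul (int (m choose Suc j)) ((bstar circ x ^^ j) x))"
proof (induction m)
  case (Suc m)
  have "cpow x (Suc m) = cpow x m + (lam circ x ^^ m) x"
    by (simp add: cpow_Suc circ_eq lam_cpow)
  also have "(lam circ x ^^ m) x = (\<Sum>j<k. zsmul (int (m choose j)) ((bstar circ x ^^ j) x))"
    using funpow_one_plus_additive[OF additive_bstar assms] by (simp flip: lam_eq_bstar)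
  finally show ?case
    by (simp add: Suc sum.distrib[symmetric] zsmul_add_left add_ac)
qed (simp add: cpow_0)

lemma lam_funpow_inverse:
  assumes "circ x x' = 0"
  shows "(lam circ x ^^ m) ((lam circ x' ^^ m) b) = b"
proof (induction m arbitrary: b)
  case (Suc m)
  have "(lam circ x ^^ Suc m) ((lam circ x' ^^ Suc m) b)
      = lam circ x ((lam circ x ^^ m) ((lam circ x' ^^ m) (lam circ x' b)))"
    by (simp add: funpow_swap1)
  also have "\<dots> = b" using Suc assms by (simp add: lam_0 flip: lam_circ)
  finally show ?case .
qed simp

text \<open>Solving for \<open>x'\<close> gives \<open>- x - bstar circ x x'\<close>, whose last
  term has depth \<open>e\<close> whatever \<open>x'\<close> is.\<close>

lemma circ_inverse_in_brace_pow:
  assumes "circ x x' = 0" "x \<in> brace_pow circ e"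
  shows "x' \<in> brace_pow circ e"
proof -
  have "bstar circ x x' \<in> brace_pow circ e"
    using bstar_in_brace_pow[OF assms(2), of x' 0] by simp
  moreover have "x' = - x - bstar circ x x'" using assms(1) by (simp add: bstar_def)
  ultimately show ?thesis
    using assms(2) by (metis add_subgroup_brace_pow add_subgroup_diff add_subgroup_minus)
qed

lemma bstar_funpow_in_brace_pow:
  assumes "x \<in> brace_pow circ e" "b \<in> brace_pow circ s"
  shows "(bstar circ x ^^ j) b \<in> brace_pow circ (e * j + s)"
proof (induction j)
  case (Suc j)
  then show ?case using bstar_in_brace_pow[OF assms(1) Suc] by (simp add: add_ac)
qed (use assms in simp)

end

section \<open>Filtered polynomial curves\<close>

text \<open>The order of the brace enters through \<open>torsion\<close>; \<open>n \<le> p\<close>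
  lets congruences modulo \<open>p^p\<close> descend to \<open>p^n\<close>.\<close>

locale nilpotent_p_brace = brace circ for circ :: "'a::ab_group_add \<Rightarrow> 'a \<Rightarrow> 'a" +
  fixes p n k \<gamma> :: nat
  assumes nilpotent: "brace_pow circ k = {0}"
    and prime: "prime p" and k_ge_2: "2 \<le> k" and k_less: "k < p" and n_le: "n \<le> p"
    and torsion: "zsmul (int p ^ n) (a :: 'a) = 0"
    and primroot: "residue_primroot (p ^ p) \<gamma>"
begin

abbreviation A :: "nat \<Rightarrow> 'a set" where "A \<equiv> brace_pow circ"

lemmas A_subgroup = add_subgroup_brace_pow[of circ]
lemmas A_zero = add_subgroup_zero[OF A_subgroup]
lemmas A_add = add_subgroup_add[OF A_subgroup]
lemmas A_zsmul = add_subgroup_zsmul[OF A_subgroup]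
lemmas A_sum = add_subgroup_sum[OF A_subgroup]

lemma A_mono: "x \<in> A j \<Longrightarrow> i \<le> j \<Longrightarrow> x \<in> A i"
  using brace_pow_antimono by blast

lemma A_vanish: "x \<in> A i \<Longrightarrow> k \<le> i \<Longrightarrow> x = 0"
  using A_mono[of x i k] nilpotent by simp

lemma zsmul_cong:
  assumes "[l = m] (mod int p ^ n)"
  shows "zsmul l (a :: 'a) = zsmul m a"
proof -
  obtain c where "l - m = c * int p ^ n"
    using assms by (auto simp: cong_iff_dvd_diff dvd_def mult.commute)
  then have "zsmul (l - m) a = zsmul c (zsmul (int p ^ n) a)" by (simp add: zsmul_zsmul)
  then show ?thesis by (simp add: torsion zs.scale_left_diff_distrib)
qed

text \<open>\<open>j\<close> is a unit modulo \<open>p^n\<close>, so dividing by it is an integer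
  multiple.\<close>

lemma exists_divided:
  assumes "0 < j" "j < p" "w \<in> A i"
  obtains w' where "w' \<in> A i" "zsmul (int j) w' = w"
proof -
  have "\<not> p dvd j" using assms by (auto dest: dvd_imp_le)
  then have "coprime (int j) (int p ^ n)"
    using prime prime_imp_coprime_nat[of p j] by (simp add: coprime_commute)
  then obtain u where "[int j * u = 1] (mod int p ^ n)"
    using cong_solve_coprime_int by blast
  then have "zsmul (int j) (zsmul u w) = w"
    using zsmul_cong[of "int j * u" 1 w] by (simp add: zsmul_zsmul)
  then show ?thesis using that A_zsmul[OF assms(3)] by blast
qed

text \<open>Polynomial curves of order at least \<open>d\<close> at \<open>0\<close>; requiring the coefficient of \<open>m^j\<close> to lie in
  \<open>A (j + s)\<close> forces all terms of degree at least \<open>k\<close> to vanish.\<close>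

inductive_set Pol :: "nat \<Rightarrow> nat \<Rightarrow> (nat \<Rightarrow> 'a) set" for d s where
  Pol_zero: "(\<lambda>_. 0) \<in> Pol d s"
| Pol_step: "\<lbrakk>f \<in> Pol d s; d \<le> j; v \<in> A (j + s)\<rbrakk>
    \<Longrightarrow> (\<lambda>m. f m + zsmul (int m ^ j) v) \<in> Pol d s"

lemma Pol_monom: "d \<le> j \<Longrightarrow> v \<in> A (j + s) \<Longrightarrow> (\<lambda>m. zsmul (int m ^ j) v) \<in> Pol d s"
  using Pol_step[OF Pol_zero] by simp

lemma Pol_add:
  assumes "f \<in> Pol d s" "g \<in> Pol d s"
  shows "(\<lambda>m. f m + g m) \<in> Pol d s"
  using assms(2)
proof induction
  case (Pol_step g j v)
  then show ?case using Pol.Pol_step[of "\<lambda>m. f m + g m"] by (simp add: add.assoc)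
qed (use assms in simp)

lemma Pol_zsmul:
  assumes "f \<in> Pol d s"
  shows "(\<lambda>m. zsmul c (f m)) \<in> Pol d s"
  using assms
proof induction
  case (Pol_step f j v)
  have "zsmul (int m ^ j) (zsmul c v) = zsmul c (zsmul (int m ^ j) v)" for m
    by (simp add: zsmul_zsmul mult.commute)
  then show ?case using Pol.Pol_step[OF Pol_step(4,2), of "zsmul c v"] Pol_step(3)
    by (simp add: zsmul_add_right A_zsmul)
qed (simp add: Pol_zero)

lemma Pol_minus: "f \<in> Pol d s \<Longrightarrow> (\<lambda>m. - f m) \<in> Pol d s"
  using Pol_zsmul[of f d s "-1"] by (simp add: zsmul_minus_left)

lemma Pol_sum: "(\<And>i. i \<in> I \<Longrightarrow> f i \<in> Pol d s) \<Longrightarrow> (\<lambda>m. \<Sum>i\<in>I. f i m) \<in> Pol d s"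
  by (induction I rule: infinite_finite_induct) (auto intro: Pol_zero Pol_add)

lemma Pol_mono:
  assumes "f \<in> Pol d s" "d' \<le> d" "s' \<le> s"
  shows "f \<in> Pol d' s'"
  using assms(1)
proof induction
  case (Pol_step f j v)
  then show ?case using assms by (intro Pol.Pol_step) (auto intro: A_mono[of v "j + s"])
qed (rule Pol_zero)

text \<open>Multiplication by \<open>m^i\<close> spends depth \<open>i\<close> to gain order
  \<open>i\<close>.\<close>

lemma Pol_shift:
  assumes "f \<in> Pol d (s + i)"
  shows "(\<lambda>m. zsmul (int m ^ i) (f m)) \<in> Pol (d + i) s"
  using assms
proof induction
  case (Pol_step f j v)
  have "(\<lambda>m. zsmul (int m ^ i) (f m) + zsmul (int m ^ (i + j)) v) \<in> Pol (d + i) s"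
    by (rule Pol.Pol_step) (use Pol_step in \<open>simp_all add: add_ac\<close>)
  then show ?case by (simp add: zsmul_add_right zsmul_zsmul power_add)
qed (simp add: Pol_zero)

lemma Pol_vanish:
  assumes "f \<in> Pol d s" "k \<le> d"
  shows "f m = 0"
  using assms(1)
proof induction
  case (Pol_step f j v)
  then show ?case using assms A_vanish[of v "j + s"] by (simp)
qed simp

text \<open>\<open>Lead d t s\<close> refines \<open>Pol d s\<close> by a separate bound \<open>t\<close> on the depth of the leading
  coefficient, the second component of the lexicographic induction in \<open>lam_Op\<close>.\<close>

definition Lead :: "nat \<Rightarrow> nat \<Rightarrow> nat \<Rightarrow> (nat \<Rightarrow> 'a) set" where
  "Lead d t s = {f. \<exists>w\<in>A t. (\<lambda>m. f m - zsmul (int m ^ d) w) \<in> Pol (Suc d) s}"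

lemma LeadI: "w \<in> A t \<Longrightarrow> (\<lambda>m. f m - zsmul (int m ^ d) w) \<in> Pol (Suc d) s \<Longrightarrow> f \<in> Lead d t s"
  by (auto simp: Lead_def)

lemma LeadE:
  assumes "f \<in> Lead d t s"
  obtains w where "w \<in> A t" "(\<lambda>m. f m - zsmul (int m ^ d) w) \<in> Pol (Suc d) s"
  using assms by (auto simp: Lead_def)

lemma Lead_imp_Pol:
  assumes "f \<in> Lead d t s" "d + s \<le> t"
  shows "f \<in> Pol d s"
proof -
  obtain w where w: "w \<in> A t" "(\<lambda>m. f m - zsmul (int m ^ d) w) \<in> Pol (Suc d) s"
    using assms(1) by (rule LeadE)
  have "(\<lambda>m. (f m - zsmul (int m ^ d) w) + zsmul (int m ^ d) w) \<in> Pol d s"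
    using w assms(2) by (intro Pol_add Pol_monom Pol_mono[OF w(2)]) (auto intro: A_mono)
  then show ?thesis by simp
qed

lemma Lead_add:
  assumes "f \<in> Lead d t s" "g \<in> Lead d t s"
  shows "(\<lambda>m. f m + g m) \<in> Lead d t s"
proof -
  obtain u where u: "u \<in> A t" "(\<lambda>m. f m - zsmul (int m ^ d) u) \<in> Pol (Suc d) s"
    using assms(1) by (rule LeadE)
  obtain v where v: "v \<in> A t" "(\<lambda>m. g m - zsmul (int m ^ d) v) \<in> Pol (Suc d) s"
    using assms(2) by (rule LeadE)
  show ?thesis
    using Pol_add[OF u(2) v(2)]
    by (intro LeadI[of "u + v"] A_add u v) (simp add: zsmul_add_right algebra_simps)
qed

lemma Lead_zsmul:
  assumes "f \<in> Lead d t s"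
  shows "(\<lambda>m. zsmul c (f m)) \<in> Lead d t s"
proof -
  obtain w where w: "w \<in> A t" "(\<lambda>m. f m - zsmul (int m ^ d) w) \<in> Pol (Suc d) s"
    using assms(1) by (rule LeadE)
  show ?thesis
    using Pol_zsmul[OF w(2), of c]
    by (intro LeadI[of "zsmul c w"] A_zsmul w) (simp add: zs.scale_right_diff_distrib zsmul_zsmul mult.commute)
qed

lemma Lead_minus: "f \<in> Lead d t s \<Longrightarrow> (\<lambda>m. - f m) \<in> Lead d t s"
  using Lead_zsmul[of f d t s "-1"] by (simp add: zsmul_minus_left)

lemma Lead_of_higher: "f \<in> Pol (Suc d) s \<Longrightarrow> f \<in> Lead d t s"
  by (rule LeadI[OF A_zero]) (simp)

lemma Lead_sum: "(\<And>i. i \<in> I \<Longrightarrow> f i \<in> Lead d t s) \<Longrightarrow> (\<lambda>m. \<Sum>i\<in>I. f i m) \<in> Lead d t s"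
  by (induction I rule: infinite_finite_induct) (auto intro: Lead_of_higher Pol_zero Lead_add)

lemma Lead_mono: "f \<in> Lead d t s \<Longrightarrow> t' \<le> t \<Longrightarrow> f \<in> Lead d t' s"
  by (auto simp: Lead_def intro: A_mono)

lemma Pol_imp_Lead:
  assumes "f \<in> Pol d s"
  shows "f \<in> Lead d (d + s) s"
  using assms
proof induction
  case Pol_zero
  show ?case by (intro Lead_of_higher Pol.Pol_zero)
next
  case (Pol_step f j v)
  have "(\<lambda>m. zsmul (int m ^ j) v) \<in> Lead d (d + s) s"
  proof (cases "j = d")
    case True
    then show ?thesis using Pol_step by (intro LeadI[of v]) (simp_all add: Pol.Pol_zero)
  next
    case False
    then show ?thesis using Pol_step by (intro Lead_of_higher Pol_monom) auto
  qed
  then show ?case using Pol_step by (intro Lead_add)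
qed

text \<open>As a polynomial in \<open>m\<close> the binomial coefficient has terms in degrees
  \<open>d\<close> to \<open>d * j\<close>, and the bound on \<open>t\<close> reserves depth for all
  of them. The denominators divide \<open>j!\<close>, a unit since \<open>j < p\<close>.\<close>

lemma binomial_Lead:
  assumes "1 \<le> j" "j < p" "1 \<le> d" "w \<in> A t" "s + d * j \<le> t"
  shows "(\<lambda>m. zsmul (int (m ^ d choose j)) w) \<in> Lead d t s"
  using assms
proof (induction j arbitrary: w s rule: dec_induct)
  case base
  then show ?case by (intro LeadI[of w]) (simp_all add: Pol_zero)
next
  case (step j)
  obtain w' where w': "w' \<in> A t" "zsmul (int (Suc j)) w' = w"
    using exists_divided[of "Suc j" w t] step.prems by auto
  have eq: "zsmul (int (m ^ d choose Suc j)) w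
      = zsmul (int m ^ d) (zsmul (int (m ^ d choose j)) w')
        + zsmul (- int j) (zsmul (int (m ^ d choose j)) w')" for m
  proof -
    have "zsmul (int (m ^ d choose Suc j)) w = zsmul (int (Suc j) * int (m ^ d choose Suc j)) w'"
      unfolding w'(2)[symmetric] by (simp add: zsmul_zsmul mult.commute)
    also have "\<dots> = zsmul (int m ^ d * int (m ^ d choose j) + (- int j) * int (m ^ d choose j)) w'"
      unfolding binomial_Suc_recurrence by simp
    finally show ?thesis by (simp only: zsmul_add_left zsmul_zsmul)
  qed
  \<comment> \<open>Using \<open>s + d\<close> stores the depth that multiplication by
    \<open>m^d\<close> will spend; the product then has order \<open>2 * d\<close>, past the leading
    term.\<close>
  have "(\<lambda>m. zsmul (int (m ^ d choose j)) w') \<in> Lead d t (s + d)"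
    using step w' by (intro step.IH) (auto simp: algebra_simps)
  then have "(\<lambda>m. zsmul (int (m ^ d choose j)) w') \<in> Pol d (s + d)"
    using step.prems step.hyps by (elim Lead_imp_Pol) (cases j; auto)
  then have "(\<lambda>m. zsmul (int m ^ d) (zsmul (int (m ^ d choose j)) w')) \<in> Pol (d + d) s"
    by (rule Pol_shift)
  then have "(\<lambda>m. zsmul (int m ^ d) (zsmul (int (m ^ d choose j)) w')) \<in> Lead d t s"
    using step.prems by (intro Lead_of_higher) (auto intro: Pol_mono)
  moreover have "(\<lambda>m. zsmul (- int j) (zsmul (int (m ^ d choose j)) w')) \<in> Lead d t s"
    using step w' by (intro Lead_zsmul step.IH) auto
  ultimately show ?case unfolding eq by (rule Lead_add)
qed

text \<open>Curves of operators equal to the identity up to order \<open>d\<close>; quantifying over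
  \<open>s\<close> measures this relative to the depth of the argument.\<close>

definition Op :: "nat \<Rightarrow> (nat \<Rightarrow> 'a \<Rightarrow> 'a) \<Rightarrow> bool" where
  "Op d Q \<longleftrightarrow> (\<forall>m. additive (Q m)) \<and> (\<forall>s b. b \<in> A s \<longrightarrow> (\<lambda>m. Q m b - b) \<in> Pol d s)"

text \<open>On a monomial \<open>m^j v\<close> the operator gains order \<open>d\<close> at depth
  \<open>s + j\<close>, and the factor \<open>m^j\<close> adds \<open>j \<ge> d'\<close>.\<close>

lemma Op_apply_diff:
  assumes Q: "Op d Q" and f: "f \<in> Pol d' s"
  shows "(\<lambda>m. Q m (f m) - f m) \<in> Pol (d + d') s"
  using f
proof induction
  case Pol_zero
  have "additive (Q m)" for m using Q by (simp add: Op_def)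
  then show ?case by (simp add: additive.zero Pol.Pol_zero)
next
  case (Pol_step f j v)
  have additive: "additive (Q m)" for m using Q by (simp add: Op_def)
  have "(\<lambda>m. Q m v - v) \<in> Pol d (s + j)" using Q Pol_step by (simp add: Op_def add.commute)
  then have "(\<lambda>m. zsmul (int m ^ j) (Q m v - v)) \<in> Pol (d + d') s"
    using Pol_step by (auto intro: Pol_mono[OF Pol_shift])
  from Pol_add[OF Pol_step.IH this] show ?case
    by (simp add: additive.add[OF additive] additive_zsmul[OF additive]
        zs.scale_right_diff_distrib algebra_simps)
qed

lemma Op_apply:
  assumes "Op d Q" "f \<in> Pol d' s"
  shows "(\<lambda>m. Q m (f m)) \<in> Pol d' s"
  using Pol_add[OF Pol_mono[OF Op_apply_diff[OF assms], of d' s] assms(2)] by simp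

lemma Op_comp:
  assumes Q: "Op d Q" and R: "Op d R"
  shows "Op d (\<lambda>m b. Q m (R m b))"
  unfolding Op_def
proof (intro conjI allI impI)
  have aQ: "additive (Q m)" and aR: "additive (R m)" for m using Q R by (simp_all add: Op_def)
  show "additive (\<lambda>b. Q m (R m b))" for m
    by (simp add: additive_def additive.add[OF aQ] additive.add[OF aR])
  fix s b assume b: "b \<in> A s"
  \<comment> \<open>\<open>Q R - 1 = Q (R - 1) + (Q - 1)\<close>.\<close>
  have "(\<lambda>m. Q m (R m b - b) + (Q m b - b)) \<in> Pol d s"
    using Q R b by (intro Pol_add Op_apply[OF Q]) (simp_all add: Op_def)
  then show "(\<lambda>m. Q m (R m b) - b) \<in> Pol d s"
    by (simp add: additive.diff[OF aQ])
qed

lemma Op_mono: "Op d Q \<Longrightarrow> d' \<le> d \<Longrightarrow> Op d' Q"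
  by (auto simp: Op_def intro: Pol_mono)

section \<open>Curves of powers\<close>

lemma bstar_nilpotent:
  assumes "x \<in> A e" "1 \<le> e"
  shows "(bstar circ x ^^ k) b = 0"
proof -
  have "(bstar circ x ^^ k) b \<in> A (e * k + 0)"
    using assms by (intro bstar_funpow_in_brace_pow) auto
  then show ?thesis using assms by (intro A_vanish) auto
qed

lemma lam_funpow_eq_sum:
  assumes "x \<in> A e" "1 \<le> e"
  shows "(lam circ x ^^ m) b = (\<Sum>j<k. zsmul (int (m choose j)) ((bstar circ x ^^ j) b))"
  using funpow_one_plus_additive[OF additive_bstar bstar_nilpotent[OF assms]] k_ge_2
  by (simp flip: lam_eq_bstar)

text \<open>The term of index \<open>j\<close> has degree \<open>d * j\<close> in \<open>m\<close>
  and coefficient at depth \<open>e * j + s\<close>, enough because \<open>d \<le> e\<close>; the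
  term \<open>j = 0\<close> is \<open>b\<close>.\<close>

lemma lam_power_Op:
  assumes "x \<in> A e" "1 \<le> d" "d \<le> e"
  shows "Op d (\<lambda>m. lam circ x ^^ (m ^ d))"
  unfolding Op_def
proof (intro conjI allI impI additive_lam_funpow)
  fix s b assume b: "b \<in> A s"
  obtain K where K: "k = Suc K" using k_ge_2 by (cases k) auto
  have "(\<lambda>m. \<Sum>j<K. zsmul (int (m ^ d choose Suc j)) ((bstar circ x ^^ Suc j) b)) \<in> Pol d s"
  proof (intro Pol_sum)
    fix j assume "j \<in> {..<K}"
    moreover have "(bstar circ x ^^ Suc j) b \<in> A (e * Suc j + s)"
      using assms b by (intro bstar_funpow_in_brace_pow)
    moreover have "d * Suc j \<le> e * Suc j" using assms by (intro mult_le_mono) auto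
    ultimately have "(\<lambda>m. zsmul (int (m ^ d choose Suc j)) ((bstar circ x ^^ Suc j) b))
        \<in> Lead d (e * Suc j + s) s"
      using assms k_less K by (intro binomial_Lead) auto
    then show "(\<lambda>m. zsmul (int (m ^ d choose Suc j)) ((bstar circ x ^^ Suc j) b)) \<in> Pol d s"
      using assms by (intro Lead_imp_Pol) (auto intro: trans_le_add1)
  qed
  then show "(\<lambda>m. (lam circ x ^^ m ^ d) b - b) \<in> Pol d s"
    using assms lam_funpow_eq_sum[OF assms(1)]
    by (simp add: K sum.lessThan_Suc_shift del: sum.lessThan_Suc funpow.simps)
qed

text \<open>The first term of the power formula is \<open>m^d x\<close>; all later coefficients
  involve \<open>x\<close> twice or more, so they lie at depth at least
  \<open>2 * e\<close>.\<close>

lemma cpow_Lead: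
  assumes "x \<in> A e" "1 \<le> d" "d \<le> e"
  shows "(\<lambda>m. cpow x (m ^ d) - zsmul (int m ^ d) x) \<in> Lead d (Suc e) 0"
proof -
  obtain K where K: "k = Suc K" using k_ge_2 by (cases k) auto
  have "(\<lambda>m. \<Sum>j<K. zsmul (int (m ^ d choose Suc (Suc j))) ((bstar circ x ^^ Suc j) x))
      \<in> Lead d (Suc e) 0"
  proof (intro Lead_sum)
    fix j assume "j \<in> {..<K}"
    moreover have "(bstar circ x ^^ Suc j) x \<in> A (e * Suc j + e)"
      using assms by (intro bstar_funpow_in_brace_pow)
    moreover have "d * Suc (Suc j) \<le> e * Suc (Suc j)" using assms by (intro mult_le_mono) auto
    ultimately have "(\<lambda>m. zsmul (int (m ^ d choose Suc (Suc j))) ((bstar circ x ^^ Suc j) x))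
        \<in> Lead d (e * Suc j + e) 0"
      using assms k_less K by (intro binomial_Lead) auto
    then show "(\<lambda>m. zsmul (int (m ^ d choose Suc (Suc j))) ((bstar circ x ^^ Suc j) x))
        \<in> Lead d (Suc e) 0"
      using assms by (elim Lead_mono) auto
  qed
  moreover have "cpow x m = (\<Sum>j<k. zsmul (int (m choose Suc j)) ((bstar circ x ^^ j) x))" for m
    using assms k_ge_2 by (intro cpow_eq_sum bstar_nilpotent[OF assms(1)]) auto
  ultimately show ?thesis
    by (simp add: K sum.lessThan_Suc_shift del: sum.lessThan_Suc funpow.simps binomial_Suc_Suc)
qed

text \<open>Dividing \<open>r\<close> on the left by the curve \<open>m \<mapsto> w^{m^d}\<close>, where \<open>w\<close> is its leading coefficient,
  pushes the leading coefficient one step deeper into the series \<open>A\<close>, until it vanishes and the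
  order increases.\<close>

lemma lam_Op:
  assumes "1 \<le> d" "d \<le> e" "r \<in> Lead d e 0"
  shows "Op d (\<lambda>m. lam circ (r m))"
  using assms
\<comment> \<open>The weight \<open>k + 1\<close> exceeds \<open>k - e\<close>, so a gain in
  \<open>d\<close> outweighs any reset of \<open>e\<close>.\<close>
proof (induction "(k - d) * (k + 1) + (k - e)" arbitrary: d e r rule: less_induct)
  case less
  obtain w where w: "w \<in> A e" and r: "(\<lambda>m. r m - zsmul (int m ^ d) w) \<in> Pol (Suc d) 0"
    using less.prems(3) by (rule LeadE)
  consider "k \<le> d" | "d < k" "k \<le> e" | "e < k" "d < k" using less.prems by linarith
  then show ?case
  proof cases
    case 1
    then have "w = 0" using less.prems A_vanish[OF w] by auto
    then have "r m = 0" for m using Pol_vanish[OF r, of m] 1 by (simp)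
    then show ?thesis by (simp add: Op_def lam_0 additive_def Pol_zero)
  next
    case 2
    then have "w = 0" using w by (intro A_vanish) auto
    with r have "r \<in> Pol (Suc d) 0" by (simp)
    then have "r \<in> Lead (Suc d) (Suc d) 0" using Pol_imp_Lead by fastforce
    moreover have "(k - Suc d) * (k + 1) + (k - Suc d) < (k - d) * (k + 1) + (k - e)"
    proof -
      have "k - d = Suc (k - Suc d)" using 2 by simp
      then show ?thesis by simp
    qed
    ultimately have "Op (Suc d) (\<lambda>m. lam circ (r m))" by (intro less.hyps) auto
    then show ?thesis by (rule Op_mono) simp
  next
    case 3
    obtain w' where inv: "circ w w' = 0" using circ_inverse_exists by blast
    have w': "w' \<in> A e" using inv w by (rule circ_inverse_in_brace_pow)
    \<comment> \<open>\<open>V\<close> inverts the action of \<open>y\<close>, so that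
      \<open>r = y \<circ> r'\<close>.\<close>
    define y where "y m = cpow w (m ^ d)" for m
    define V where "V m = lam circ w' ^^ (m ^ d)" for m
    define r' where "r' m = V m (r m - y m)" for m
    have y: "(\<lambda>m. y m - zsmul (int m ^ d) w) \<in> Lead d (Suc e) 0"
      unfolding y_def using w less.prems by (intro cpow_Lead)
    have V: "Op d V"
      unfolding V_def using w' less.prems by (intro lam_power_Op)
    \<comment> \<open>The leading coefficients of \<open>r\<close> and \<open>y\<close> agree up to
      depth \<open>e + 1\<close>.\<close>
    have "(\<lambda>m. (r m - zsmul (int m ^ d) w) + - (y m - zsmul (int m ^ d) w)) \<in> Lead d (Suc e) 0"
      by (intro Lead_add Lead_minus y Lead_of_higher r)
    then have ry: "(\<lambda>m. r m - y m) \<in> Lead d (Suc e) 0" by simp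
    then have "(\<lambda>m. r m - y m) \<in> Pol d 0" using less.prems by (intro Lead_imp_Pol[OF ry]) auto
    \<comment> \<open>Applying \<open>V\<close> changes the curve only beyond order
      \<open>d\<close>.\<close>
    from Op_apply_diff[OF V this] have "(\<lambda>m. r' m - (r m - y m)) \<in> Pol (Suc d) 0"
      unfolding r'_def using less.prems by (auto intro: Pol_mono)
    from Lead_add[OF Lead_of_higher[OF this] ry] have "r' \<in> Lead d (Suc e) 0" by simp
    then have "Op d (\<lambda>m. lam circ (r' m))"
      using less.prems 3 by (intro less.hyps) auto
    from Op_comp[OF lam_power_Op[OF w less.prems(1,2)] this]
    have "Op d (\<lambda>m b. (lam circ w ^^ (m ^ d)) (lam circ (r' m) b))" .
    moreover have "r m = circ (y m) (r' m)" for m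
      by (simp add: circ_eq y_def lam_cpow r'_def V_def lam_funpow_inverse[OF inv])
    then have "lam circ (r m) = (\<lambda>b. (lam circ w ^^ (m ^ d)) (lam circ (r' m) b))" for m
      by (simp add: lam_circ y_def lam_cpow fun_eq_iff)
    ultimately show ?thesis by simp
  qed
qed

end

section \<open>Coefficient extraction\<close>

context nilpotent_p_brace
begin

definition xi :: nat where "xi = \<gamma> ^ (p ^ (p - 1))"

lemma xi_power: "[int xi ^ (p - 1) = 1] (mod int p ^ n)"
  unfolding xi_def
  by (rule cong_dvd_modulus[OF primroot_teichmuller(1)[OF prime primroot]])
     (simp add: le_imp_power_dvd n_le)

text \<open>Factor out the smaller power; the rest is prime to \<open>p\<close> because
  \<open>xi\<close> has exact order \<open>p - 1\<close> modulo \<open>p\<close>.\<close>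

lemma xi_powers_differ:
  assumes "l < p - 1" "j < p - 1" "j \<noteq> l"
  shows "coprime (int xi ^ j - int xi ^ l) (int p ^ n)"
  using assms
proof (induction l j rule: linorder_wlog)
  case (le l j)
  have "int xi ^ j - int xi ^ l = int xi ^ l * (int xi ^ (j - l) - 1)"
    using le by (simp add: right_diff_distrib flip: power_add)
  moreover have "coprime (int xi ^ l) (int p ^ n)"
    using primroot_teichmuller(3)[OF prime primroot] unfolding xi_def by simp
  moreover have "coprime (int xi ^ (j - l) - 1) (int p ^ n)"
  proof -
    have "\<not> int p dvd int xi ^ (j - l) - 1"
      using primroot_teichmuller(2)[OF prime primroot, of "j - l"] le
      unfolding xi_def by (simp add: cong_iff_dvd_diff)
    then have "coprime (int p) (int xi ^ (j - l) - 1)"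
      using prime by (intro prime_imp_coprime) auto
    then show ?thesis by (simp add: coprime_commute)
  qed
  ultimately show ?case by (simp only: coprime_mult_left_iff)
next
  case (sym l j)
  then have "coprime (int xi ^ l - int xi ^ j) (int p ^ n)" by simp
  then have "coprime (- (int xi ^ l - int xi ^ j)) (int p ^ n)"
    by (simp only: coprime_minus_left_iff)
  then show ?case by simp
qed

text \<open>For \<open>j = l\<close> each summand is a power of \<open>xi^(p-1)\<close>. Otherwise,
  with \<open>x = xi^j\<close> and \<open>y = xi^l\<close>, the sum is \<open>y\<close> times the
  quotient of \<open>x^(p-1) - y^(p-1)\<close> by the unit \<open>x - y\<close>.\<close>

lemma xi_orthogonality:
  assumes "l < p - 1" "j < p - 1"
  shows "[(\<Sum>i\<in>{0..p-2}. int xi ^ ((p - 1 - i) * l) * (int xi ^ i) ^ j)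
    = (if j = l then int p - 1 else 0)] (mod int p ^ n)" (is "[?S = _] (mod _)")
proof -
  have p2: "p \<ge> 2" using prime by (rule prime_ge_2_nat)
  have set: "{0..p-2} = {..<p-1}" using p2 by auto
  show ?thesis
  proof (cases "j = l")
    case True
    have "[?S = (\<Sum>i\<in>{0..p-2}. 1)] (mod int p ^ n)"
    proof (rule cong_sum)
      fix i assume i: "i \<in> {0..p-2}"
      have "int xi ^ ((p - 1 - i) * l) * (int xi ^ i) ^ j = (int xi ^ (p - 1)) ^ l"
        using True i p2 by (simp flip: power_mult power_add add_mult_distrib)
      also have "[\<dots> = 1 ^ l] (mod int p ^ n)" by (intro cong_pow xi_power)
      finally show "[int xi ^ ((p - 1 - i) * l) * (int xi ^ i) ^ j = 1] (mod int p ^ n)" by simp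
    qed
    then show ?thesis using True p2 by (simp add: set of_nat_diff)
  next
    case False
    let ?x = "int xi ^ j" and ?y = "int xi ^ l"
    let ?T = "\<Sum>i<p - 1. ?y ^ (p - 1 - Suc i) * ?x ^ i"
    have "?S = ?y * ?T"
      unfolding set sum_distrib_left
    proof (rule sum.cong)
      fix i assume "i \<in> {..<p - 1}"
      then have "p - 1 - i = Suc (p - 1 - Suc i)" by auto
      then have "int xi ^ ((p - 1 - i) * l) = ?y * ?y ^ (p - 1 - Suc i)"
        by (metis power_Suc power_mult mult.commute)
      then show "int xi ^ ((p - 1 - i) * l) * (int xi ^ i) ^ j = ?y * (?y ^ (p - 1 - Suc i) * ?x ^ i)"
        by (simp add: mult.assoc flip: power_mult) (simp add: mult.commute)
    qed simp
    moreover have "int p ^ n dvd ?T"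
    proof -
      have "[?x ^ (p - 1) = 1 ^ j] (mod int p ^ n)" "[?y ^ (p - 1) = 1 ^ l] (mod int p ^ n)"
        using cong_pow[OF xi_power] by (metis power_mult mult.commute)+
      then have "[?x ^ (p - 1) = ?y ^ (p - 1)] (mod int p ^ n)"
        by (metis power_one cong_sym cong_trans)
      then have "int p ^ n dvd (?x - ?y) * ?T"
        by (simp only: cong_iff_dvd_diff power_diff_sumr2)
      moreover have "coprime (int p ^ n) (?x - ?y)"
        using xi_powers_differ[OF assms False] by (simp only: coprime_commute)
      ultimately show ?thesis using coprime_dvd_mult_right_iff by blast
    qed
    ultimately show ?thesis using False by (simp add: cong_0_iff)
  qed
qed

text \<open>The factor \<open>-(1 + p + \<dots> + p^(n-1))\<close> is the inverse of \<open>p - 1\<close> modulo \<open>p^n\<close>, and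
  \<open>xi ^ ((p - 1 - i) * l)\<close> represents \<open>xi\<close> to the power \<open>-i l\<close>.\<close>

definition coef :: "nat \<Rightarrow> (nat \<Rightarrow> 'a) \<Rightarrow> 'a" where
  "coef l f = zsmul (- int (\<Sum>i<n. p ^ i))
     (\<Sum>i\<in>{0..p-2}. zsmul (int (xi ^ ((p - 1 - i) * l))) (f (xi ^ i)))"

lemma preLie_odot_eq_coef:
  "preLie_odot circ p n \<gamma> a b = coef 1 (\<lambda>m. bstar circ (zsmul (int m) a) b)"
  by (simp add: preLie_odot_def preLie_dot_def coef_def xi_def Let_def)

lemma coef_add: "coef l (\<lambda>m. f m + g m) = coef l f + coef l g"
  by (simp add: coef_def zsmul_add_right sum.distrib)

lemma coef_additive:
  assumes "additive g"
  shows "coef l (\<lambda>m. g (f m)) = g (coef l f)"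
  by (simp only: coef_def additive_zsmul[OF assms] additive.sum[OF assms])

lemma coef_zero: "coef l (\<lambda>m. 0) = 0"
  by (simp add: coef_def)

lemma coef_sum: "coef l (\<lambda>m. \<Sum>i\<in>I. f i m) = (\<Sum>i\<in>I. coef l (f i))"
  by (induction I rule: infinite_finite_induct) (simp_all add: coef_zero coef_add)

lemma coef_monom:
  assumes "l < p - 1" "j < p - 1"
  shows "coef l (\<lambda>m. zsmul (int m ^ j) v) = (if j = l then v else 0)"
proof -
  let ?c = "- int (\<Sum>i<n. p ^ i)"
  let ?S = "\<Sum>i\<in>{0..p-2}. int xi ^ ((p - 1 - i) * l) * (int xi ^ i) ^ j"
  have "coef l (\<lambda>m. zsmul (int m ^ j) v) = zsmul (?c * ?S) v"
    by (simp only: coef_def zsmul_zsmul[symmetric] zs.scale_sum_left of_nat_power)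
  moreover have "[?c * ?S = ?c * (if j = l then int p - 1 else 0)] (mod int p ^ n)"
    by (intro cong_scalar_left xi_orthogonality assms)
  moreover have "?c * (int p - 1) = 1 - int p ^ n"
    using power_diff_1_eq[of "int p" n] by (simp add: algebra_simps)
  then have "[?c * (int p - 1) = 1] (mod int p ^ n)"
    by (simp add: cong_iff_dvd_diff)
  ultimately have "[?c * ?S = (if j = l then 1 else 0)] (mod int p ^ n)"
    by (auto intro: cong_trans split: if_splits)
  from zsmul_cong[OF this, of v] show ?thesis
    using \<open>coef l _ = _\<close> by auto
qed

text \<open>Extraction sees degrees only modulo \<open>p - 1\<close>, but from degree
  \<open>p - 1 \<ge> k\<close> on the depth forces \<open>v = 0\<close>.\<close>

lemma coef_monom_Pol:
  assumes "l < p - 1" "v \<in> A (j + s)"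
  shows "coef l (\<lambda>m. zsmul (int m ^ j) v) = (if j = l then v else 0)"
proof (cases "j < p - 1")
  case False
  then have "v = 0" using A_vanish[OF assms(2)] k_less by auto
  then show ?thesis by (simp add: coef_zero)
qed (use coef_monom assms in simp)

lemma coef_const: "0 < l \<Longrightarrow> l < p - 1 \<Longrightarrow> coef l (\<lambda>m. v) = 0"
  using coef_monom[of l 0 v] by simp

lemma coef_below_order:
  assumes "f \<in> Pol d s" "l < d" "l < p - 1"
  shows "coef l f = 0"
  using assms(1)
proof induction
  case (Pol_step f j v)
  then show ?case using assms coef_monom_Pol[of l v j s] by (simp add: coef_add)
qed (rule coef_zero)

text \<open>By linearity it suffices to recover monomials; those of degree at least
  \<open>p - 1\<close> are zero.\<close>

lemma Pol_eq_sum_coef: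
  assumes "f \<in> Pol d s"
  shows "f m = (\<Sum>l<p-1. zsmul (int m ^ l) (coef l f))"
  using assms
proof induction
  case (Pol_step f j v)
  have "zsmul (int m ^ j) v = (\<Sum>l<p-1. zsmul (int m ^ l) (if j = l then v else 0))"
  proof (cases "j < p - 1")
    case True
    then show ?thesis by (simp add: if_distrib[of "zsmul _"] cong: if_cong)
  next
    case False
    then have "v = 0" using A_vanish[OF Pol_step(3)] k_less by auto
    then show ?thesis by (simp cong: if_cong)
  qed
  also have "\<dots> = (\<Sum>l<p-1. zsmul (int m ^ l) (coef l (\<lambda>m. zsmul (int m ^ j) v)))"
    using coef_monom_Pol[OF _ Pol_step(3)] by (intro sum.cong) auto
  finally show ?case
    by (simp add: coef_add zsmul_add_right sum.distrib Pol_step.IH)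
qed (simp add: coef_zero)

lemma p_gt_2: "2 < p"
  using k_ge_2 k_less by simp

lemma coef_1_translate:
  assumes "j < p - 1"
  shows "coef 1 (\<lambda>m. zsmul (int (m' + m) ^ j) v) = zsmul (int j * int m' ^ (j - 1)) v"
proof -
  have "int (m' + m) ^ j = (\<Sum>i\<le>j. (of_nat (j choose i) * int m' ^ (j - i)) * int m ^ i)" for m
    using binomial_ring[of "int m" "int m'" j] by (simp add: algebra_simps)
  then have "coef 1 (\<lambda>m. zsmul (int (m' + m) ^ j) v)
      = coef 1 (\<lambda>m. \<Sum>i\<le>j. zsmul (int m ^ i) (zsmul (of_nat (j choose i) * int m' ^ (j - i)) v))"
    by (simp add: zs.scale_sum_left zsmul_zsmul mult.commute)
  also have "\<dots> = (\<Sum>i\<le>j. if i = 1 then zsmul (of_nat (j choose i) * int m' ^ (j - i)) v else 0)"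
    unfolding coef_sum using assms p_gt_2 by (intro sum.cong refl coef_monom) auto
  also have "\<dots> = zsmul (int j * int m' ^ (j - 1)) v"
    \<comment> \<open>For \<open>j = 0\<close> there is no linear term, and the factor
      \<open>j\<close> makes the truncated exponent harmless.\<close>
    by (cases "j = 0") (auto simp: sum.delta)
  finally show ?thesis .
qed

text \<open>Differentiating \<open>h (m' + m) = c m' + E m' (h m)\<close> with respect to \<open>m\<close> at \<open>m = 0\<close> gives
  the differential equation \<open>h' = E h'(0)\<close>, read off coefficientwise.\<close>

lemma coef_translation_equation:
  assumes E: "\<And>m. additive (E m)" and h: "h \<in> Pol d s"
    and eq: "\<And>m' m. h (m' + m) = c m' + E m' (h m)"
    and l: "Suc l < p - 1"
  shows "zsmul (int (Suc l)) (coef (Suc l) h) = coef l (\<lambda>m. E m (coef 1 h))"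
proof -
  \<comment> \<open>Extract the coefficient of \<open>m\<close> at fixed \<open>m'\<close>:
    \<open>c m'\<close> drops out and \<open>E m'\<close> commutes with the extraction.\<close>
  have "E m' (coef 1 h) = (\<Sum>j<p-1. zsmul (int j * int m' ^ (j - 1)) (coef j h))" for m'
  proof -
    have "coef 1 (\<lambda>m. h (m' + m)) = coef 1 (\<lambda>m. \<Sum>j<p-1. zsmul (int (m' + m) ^ j) (coef j h))"
      by (subst Pol_eq_sum_coef[OF h]) simp
    also have "\<dots> = (\<Sum>j<p-1. zsmul (int j * int m' ^ (j - 1)) (coef j h))"
      unfolding coef_sum by (intro sum.cong refl coef_1_translate) auto
    finally show ?thesis
      using p_gt_2 by (simp add: eq coef_add coef_const coef_additive[OF E])
  qed
  then have "coef l (\<lambda>m. E m (coef 1 h))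
      = (\<Sum>j<p-1. coef l (\<lambda>m. zsmul (int m ^ (j - 1)) (zsmul (int j) (coef j h))))"
    by (simp add: coef_sum zsmul_zsmul mult.commute)
  \<comment> \<open>The degree is now \<open>j - 1\<close>, so only \<open>j = l + 1\<close>
    survives.\<close>
  also have "\<dots> = (\<Sum>j<p-1. if j = Suc l then zsmul (int j) (coef j h) else 0)"
  proof (rule sum.cong)
    fix j assume j: "j \<in> {..<p-1}"
    show "coef l (\<lambda>m. zsmul (int m ^ (j - 1)) (zsmul (int j) (coef j h)))
        = (if j = Suc l then zsmul (int j) (coef j h) else 0)"
    proof (cases j)
      case (Suc i)
      then show ?thesis
        using coef_monom[of l i "zsmul (int j) (coef j h)"] l j by simp
    qed (simp add: coef_zero)
  qed simp
  also have "\<dots> = zsmul (int (Suc l)) (coef (Suc l) h)"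
    using l by (simp add: sum.delta)
  finally show ?thesis by simp
qed

section \<open>The exponential\<close>

abbreviation odot :: "'a \<Rightarrow> 'a \<Rightarrow> 'a" where "odot \<equiv> preLie_odot circ p n \<gamma>"

lemma odot_in_A: "b \<in> A s \<Longrightarrow> odot a b \<in> A (Suc s)"
  unfolding preLie_odot_eq_coef coef_def
  using bstar_in_brace_pow[of _ circ 1 b s] by (intro A_zsmul A_sum) simp

lemma odot_funpow_in_A: "b \<in> A s \<Longrightarrow> (odot a ^^ j) b \<in> A (j + s)"
  by (induction j) (auto intro: odot_in_A)

lemma additive_odot: "additive (odot a)"
proof
  fix b c show "odot a (b + c) = odot a b + odot a c"
    unfolding preLie_odot_eq_coef
    by (simp add: additive.add[OF additive_bstar] coef_add)
qed

text \<open>The initial velocity of the curve of powers of \<open>x\<close>; it will be identified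
  with \<open>\<Omega>(x)\<close>.\<close>

definition log_vec :: "'a \<Rightarrow> 'a" where "log_vec x = coef 1 (cpow x)"

lemma lam_funpow_Op: "Op 1 (\<lambda>m. lam circ x ^^ m)"
  using lam_power_Op[of x 1 1] by simp

lemma lam_funpow_Pol: "(\<lambda>m. (lam circ x ^^ m) b) \<in> Pol 0 0"
proof -
  have "(\<lambda>m. (lam circ x ^^ m) b - b) \<in> Pol 1 0"
    using lam_funpow_Op[of x] by (simp add: Op_def)
  then have "(\<lambda>m. (lam circ x ^^ m) b - b) \<in> Pol 0 0"
    by (rule Pol_mono) auto
  from Pol_add[OF this Pol_monom[of 0 0 b 0]] show ?thesis by simp
qed

text \<open>By \<open>cpow_Lead\<close> with \<open>d = e = 1\<close> the curve is
  \<open>m (x + w)\<close> up to second order, which forces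
  \<open>log_vec x = x + w\<close>.\<close>

lemma cpow_Pol_2: "(\<lambda>m. zsmul (int m) (log_vec x) - cpow x m) \<in> Pol 2 0"
  and cpow_Pol: "cpow x \<in> Pol 1 0"
proof -
  have "(\<lambda>m. cpow x m - zsmul (int m) x) \<in> Lead 1 2 0"
    using cpow_Lead[of x 1 1] by (simp add: numeral_2_eq_2)
  then obtain w where w: "(\<lambda>m. cpow x m - zsmul (int m) x - zsmul (int m ^ 1) w) \<in> Pol (Suc 1) 0"
    by (rule LeadE)
  have P: "(\<lambda>m. cpow x m - zsmul (int m ^ 1) (x + w)) \<in> Pol 2 0"
    using w by (simp add: zsmul_add_right diff_diff_eq numeral_2_eq_2)
  have "coef 1 (\<lambda>m. (cpow x m - zsmul (int m ^ 1) (x + w)) + zsmul (int m ^ 1) (x + w)) = x + w"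
    unfolding coef_add using p_gt_2
    by (simp only: coef_below_order[OF P] coef_monom) simp
  then have lv: "log_vec x = x + w" by (simp add: log_vec_def)
  show "(\<lambda>m. zsmul (int m) (log_vec x) - cpow x m) \<in> Pol 2 0"
    using Pol_minus[OF P] by (simp add: lv)
  have "(\<lambda>m. (cpow x m - zsmul (int m ^ 1) (x + w)) + zsmul (int m ^ 1) (x + w)) \<in> Pol 1 0"
    using P by (intro Pol_add Pol_monom) (auto intro: Pol_mono)
  then show "cpow x \<in> Pol 1 0" by simp
qed

lemma odot_log_vec: "odot (log_vec x) b = coef 1 (\<lambda>m. (lam circ x ^^ m) b)"
proof -
  obtain x' where inv: "circ x x' = 0" using circ_inverse_exists by blast
  \<comment> \<open>The solution of \<open>m a = x^m \<circ> r(m)\<close> for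
    \<open>a = log_vec x\<close>, with \<open>x^m\<close> the multiplicative power.\<close>
  define r where "r m = (lam circ x' ^^ m) (zsmul (int m) (log_vec x) - cpow x m)" for m
  have "r \<in> Pol 2 0"
    unfolding r_def using lam_funpow_Op cpow_Pol_2 by (rule Op_apply)
  then have "r \<in> Lead 2 2 0" using Pol_imp_Lead by fastforce
  then have "Op 2 (\<lambda>m. lam circ (r m))" by (intro lam_Op) auto
  then have "(\<lambda>m. lam circ (r m) b - b) \<in> Pol 2 0" by (simp add: Op_def)
  then have P: "(\<lambda>m. (lam circ x ^^ m) (lam circ (r m) b - b)) \<in> Pol 2 0"
    by (rule Op_apply[OF lam_funpow_Op])
  have "zsmul (int m) (log_vec x) = circ (cpow x m) (r m)" for m
    by (simp add: circ_eq lam_cpow r_def lam_funpow_inverse[OF inv])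
  \<comment> \<open>The first summand has order 2 and the last is constant, so neither contributes
    to the coefficient of \<open>m\<close>.\<close>
  then have "bstar circ (zsmul (int m) (log_vec x)) b
      = (lam circ x ^^ m) (lam circ (r m) b - b) + (lam circ x ^^ m) b + - b" for m
    by (simp add: bstar_eq_lam lam_circ lam_cpow additive.diff[OF additive_lam_funpow])
  then have "odot (log_vec x) b = coef 1 (\<lambda>m. (lam circ x ^^ m) (lam circ (r m) b - b))
      + coef 1 (\<lambda>m. (lam circ x ^^ m) b) + coef 1 (\<lambda>m. - b)"
    by (simp only: preLie_odot_eq_coef coef_add)
  then show ?thesis using coef_below_order[OF P, of 1] coef_const[of 1 "- b"] p_gt_2 by simp
qed

text \<open>The translation equation lowers the degree by one and replaces \<open>b\<close> by
  \<open>odot (log_vec x) b\<close>, whence \<open>b\<close> is arbitrary; degree 0 is the value at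
  \<open>m = 0\<close>.\<close>

lemma coef_lam_funpow:
  assumes "l < p - 1"
  shows "zsmul (fact l) (coef l (\<lambda>m. (lam circ x ^^ m) b)) = (odot (log_vec x) ^^ l) b"
  using assms
proof (induction l arbitrary: b)
  case 0
  have "(lam circ x ^^ 0) b = (\<Sum>l<p-1. zsmul (int 0 ^ l) (coef l (\<lambda>m. (lam circ x ^^ m) b)))"
    by (rule Pol_eq_sum_coef[OF lam_funpow_Pol])
  also have "\<dots> = (\<Sum>l<p-1. if l = 0 then coef l (\<lambda>m. (lam circ x ^^ m) b) else 0)"
    by (intro sum.cong) (auto simp: power_0_left)
  finally show ?case using 0 by (simp add: sum.delta)
next
  case (Suc l)
  let ?D = "odot (log_vec x)"
  have "zsmul (int (Suc l)) (coef (Suc l) (\<lambda>m. (lam circ x ^^ m) b))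
      = coef l (\<lambda>m. (lam circ x ^^ m) (?D b))"
    unfolding odot_log_vec
    by (rule coef_translation_equation[OF additive_lam_funpow lam_funpow_Pol, where c = "\<lambda>_. 0"])
       (use Suc.prems in \<open>simp_all add: funpow_add\<close>)
  then have "zsmul (fact l) (zsmul (int (Suc l)) (coef (Suc l) (\<lambda>m. (lam circ x ^^ m) b)))
      = (?D ^^ l) (?D b)"
    using Suc by simp
  then show ?case by (simp add: zsmul_zsmul mult.commute funpow_swap1)
qed

text \<open>One use of the translation equation reduces this to \<open>coef_lam_funpow\<close> at
  \<open>b = log_vec x\<close>.\<close>

lemma coef_cpow:
  assumes "Suc l < p - 1"
  shows "zsmul (fact (Suc l)) (coef (Suc l) (cpow x)) = (odot (log_vec x) ^^ l) (log_vec x)"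
proof -
  have "zsmul (int (Suc l)) (coef (Suc l) (cpow x))
      = coef l (\<lambda>m. (lam circ x ^^ m) (coef 1 (cpow x)))"
    by (rule coef_translation_equation[OF additive_lam_funpow cpow_Pol, where c = "cpow x"])
       (use assms in \<open>simp_all add: cpow_add circ_eq lam_cpow\<close>)
  then have "zsmul (fact l) (zsmul (int (Suc l)) (coef (Suc l) (cpow x)))
      = (odot (log_vec x) ^^ l) (log_vec x)"
    using coef_lam_funpow[of l] assms by (simp add: log_vec_def)
  then show ?thesis by (simp add: zsmul_zsmul mult.commute)
qed

text \<open>\<open>j!\<close> is prime to \<open>p\<close>, so exactly one residue fits and
  \<open>THE\<close> denotes it.\<close>

lemma inv_fact_mod_cong:
  assumes "j < p"
  shows "[inv_fact_mod (p ^ n) j * fact j = 1] (mod int p ^ n)"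
proof -
  let ?P = "\<lambda>u. u \<in> {0..<int (p ^ n)} \<and> [u * int (fact j) = 1] (mod int (p ^ n))"
  have "\<not> p dvd fact j" using assms prime by (simp add: prime_dvd_fact_iff)
  then have cop: "coprime (int (fact j)) (int (p ^ n))"
    using prime prime_imp_coprime_nat[of p "fact j"]
    by (simp only: coprime_int_iff coprime_commute coprime_power_right_iff) simp
  then obtain v where v: "[int (fact j) * v = 1] (mod int (p ^ n))"
    using cong_solve_coprime_int by blast
  have pos: "int (p ^ n) > 0" using prime by (simp add: prime_gt_0_nat)
  have "?P (v mod int (p ^ n))"
    using v pos by (auto simp: cong_def mod_mult_right_eq mult.commute)
  moreover have "u = u'" if "?P u" "?P u'" for u u'
  proof -
    have "[u * int (fact j) = u' * int (fact j)] (mod int (p ^ n))"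
      using that by (metis cong_sym cong_trans)
    then have "[u = u'] (mod int (p ^ n))"
      using cop cong_mult_rcancel by blast
    then show ?thesis using that by (auto simp: cong_def)
  qed
  ultimately have "?P (inv_fact_mod (p ^ n) j)"
    unfolding inv_fact_mod_def by (intro theI[of ?P]) blast+
  then show ?thesis by simp
qed

lemma zsmul_inv_fact:
  assumes "j < p" "zsmul (fact j) u = (v :: 'a)"
  shows "zsmul (inv_fact_mod (p ^ n) j) v = u"
  unfolding assms(2)[symmetric]
  using zsmul_cong[OF inv_fact_mod_cong[OF assms(1)], of u] by (simp add: zsmul_zsmul)

text \<open>Evaluate the curve \<open>\<lambda>_x^m(b)\<close> at \<open>m = 1\<close> and divide
  each coefficient by its factorial.\<close>

lemma lam_eq_exp:
  "lam circ x b = (\<Sum>l<p-1. zsmul (inv_fact_mod (p ^ n) l) ((odot (log_vec x) ^^ l) b))"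
proof -
  have "lam circ x b = (\<Sum>l<p-1. zsmul (int 1 ^ l) (coef l (\<lambda>m. (lam circ x ^^ m) b)))"
    by (subst Pol_eq_sum_coef[OF lam_funpow_Pol, symmetric]) simp
  also have "\<dots> = (\<Sum>l<p-1. zsmul (inv_fact_mod (p ^ n) l) ((odot (log_vec x) ^^ l) b))"
    by (intro sum.cong refl) (use zsmul_inv_fact[OF _ coef_lam_funpow] in auto)
  finally show ?thesis .
qed

text \<open>Evaluate the curve of powers at \<open>m = 1\<close>; its constant term vanishes, which
  leaves \<open>p - 2\<close> summands.\<close>

lemma eq_flow_log_vec:
  "x = (\<Sum>l<p-2. zsmul (inv_fact_mod (p ^ n) (Suc l)) ((odot (log_vec x) ^^ l) (log_vec x)))"
proof -
  have pp: "p - 1 = Suc (p - 2)" using p_gt_2 by simp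
  have "cpow x 1 = (\<Sum>l<p-1. zsmul (int 1 ^ l) (coef l (cpow x)))"
    by (rule Pol_eq_sum_coef[OF cpow_Pol])
  also have "\<dots> = coef 0 (cpow x) + (\<Sum>l<p-2. coef (Suc l) (cpow x))"
    unfolding pp by (simp add: sum.lessThan_Suc_shift del: sum.lessThan_Suc)
  also have "coef 0 (cpow x) = 0"
    using p_gt_2 by (intro coef_below_order[OF cpow_Pol]) auto
  also have "0 + (\<Sum>l<p-2. coef (Suc l) (cpow x))
      = (\<Sum>l<p-2. zsmul (inv_fact_mod (p ^ n) (Suc l)) ((odot (log_vec x) ^^ l) (log_vec x)))"
    unfolding add_0
    by (intro sum.cong refl) (use zsmul_inv_fact[OF _ coef_cpow] p_gt_2 in auto)
  finally show ?thesis unfolding cpow_1 .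
qed

section \<open>Comparison with the group of flows\<close>

lemma L_op_funpow: "(L_op odot a ^^ j) (b, 0) = ((odot a ^^ j) b, 0)"
  by (induction j) (simp_all add: L_op_def id_odot_def)

lemma L_op_funpow_one: "(L_op odot a ^^ Suc j) (0, 1) = ((odot a ^^ j) a, 0)"
  unfolding funpow_Suc_right comp_def
  by (simp add: L_op_def[of _ _ "(0, 1)"] id_odot_def additive.zero[OF additive_odot] L_op_funpow)

text \<open>Any vanishing bound may replace the least one, as the extra summands are zero.\<close>

lemma expL_eq_sum:
  assumes "\<forall>i\<ge>K. (L_op odot a ^^ i) x = 0"
  shows "expL odot q a x = (\<Sum>j<K. id_scale (inv_fact_mod q j) ((L_op odot a ^^ j) x))"
proof -
  let ?P = "\<lambda>N. \<forall>i\<ge>N. (L_op odot a ^^ i) x = 0"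
  define N where "N = Least ?P"
  have N: "?P N" and "N \<le> K"
    unfolding N_def using assms by (rule LeastI[of ?P K], rule Least_le[of ?P K])
  have "id_scale (inv_fact_mod q i) ((L_op odot a ^^ i) x) = 0" if "N \<le> i" for i
  proof -
    have "(L_op odot a ^^ i) x = 0" using N that by blast
    then show ?thesis by (simp add: id_scale_def zero_prod_def)
  qed
  with \<open>N \<le> K\<close> show ?thesis
    unfolding expL_def N_def[symmetric] by (intro sum.mono_neutral_left) auto
qed

lemma expL_log_vec: "expL odot (p ^ n) (log_vec x) (b, 0) = (lam circ x b, 0)"
proof -
  \<comment> \<open>The iterate has depth \<open>i \<ge> p - 1 \<ge> k\<close>.\<close>
  have "(L_op odot (log_vec x) ^^ i) (b, 0) = 0" if "p - 1 \<le> i" for i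
    using A_vanish[OF odot_funpow_in_A[of b 0 i "log_vec x"]] that k_less
    by (simp add: L_op_funpow zero_prod_def)
  then show ?thesis
    by (subst expL_eq_sum[where K = "p - 1"])
       (simp_all add: prod_eq_iff fst_sum snd_sum L_op_funpow id_scale_def lam_eq_exp)
qed

lemma flowW_log_vec: "flowW odot (p ^ n) (log_vec x) = x"
proof -
  have pp: "p - 1 = Suc (p - 2)" using p_gt_2 by simp
  have "(L_op odot (log_vec x) ^^ i) (0, 1) = 0" if i: "p - 1 \<le> i" for i
  proof -
    obtain j where j: "i = Suc j" using i p_gt_2 by (cases i) auto
    have "(odot (log_vec x) ^^ j) (log_vec x) = 0"
      using A_vanish[OF odot_funpow_in_A[of "log_vec x" 1 j "log_vec x"]] i k_less j by simp
    then show ?thesis unfolding j L_op_funpow_one by (simp add: zero_prod_def)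
  qed
  then have "flowW odot (p ^ n) (log_vec x) =
      (\<Sum>j<p-1. fst (id_scale (inv_fact_mod (p ^ n) j) ((L_op odot (log_vec x) ^^ j) (0, 1))))"
    unfolding flowW_def by (subst expL_eq_sum[where K = "p - 1"]) (simp_all add: fst_sum)
  also have "\<dots> = (\<Sum>j<p-2. zsmul (inv_fact_mod (p ^ n) (Suc j)) ((odot (log_vec x) ^^ j) (log_vec x)))"
    unfolding pp sum.lessThan_Suc_shift L_op_funpow_one by (simp add: id_scale_def)
  also have "\<dots> = x" by (rule eq_flow_log_vec[symmetric])
  finally show ?thesis .
qed

text \<open>\<open>log_vec\<close> is a right inverse of \<open>W\<close>, and a surjection of a
  finite set onto itself is injective.\<close>

lemma flowOmega_eq_log_vec:
  assumes "finite (UNIV :: 'a set)"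
  shows "flowOmega odot (p ^ n) x = log_vec x"
proof -
  have "surj (flowW odot (p ^ n))" by (rule surjI) (rule flowW_log_vec)
  then have "inj (flowW odot (p ^ n))" using assms finite_UNIV_surj_inj by blast
  then show ?thesis unfolding flowOmega_def by (rule inv_f_eq) (rule flowW_log_vec)
qed

end

theorem theorem12:
  fixes circ :: "'a::ab_group_add \<Rightarrow> 'a \<Rightarrow> 'a"
    and p n k \<gamma> :: nat
  assumes "is_brace circ"
    and "strongly_nilpotent circ"
    and "nilpotency_index circ k"
    and "finite (UNIV :: 'a set)"
    and "card (UNIV :: 'a set) = p ^ n"
    and "prime p" and "k < p" and "n + 1 < p"
    and "residue_primroot (p ^ p) \<gamma>"
  shows "\<forall>a b. (circ a b, 0) =
           (a, 0) + expL (preLie_odot circ p n \<gamma>) (p ^ n)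
                      (flowOmega (preLie_odot circ p n \<gamma>) (p ^ n) a) (b, 0)"
proof -
  \<comment> \<open>Indices \<open>0\<close> and \<open>1\<close> both give the whole brace, so for
    \<open>k \<le> 1\<close> the sets at \<open>k\<close> and \<open>k - 1\<close> would
    coincide.\<close>
  have "2 \<le> k"
  proof (rule ccontr)
    assume "\<not> 2 \<le> k"
    then have "k = 0 \<or> k = 1" by linarith
    then have "brace_pow circ k = UNIV" "brace_pow circ (k - 1) = UNIV" by auto
    with assms(3) show False unfolding nilpotency_index_def by metis
  qed
  then interpret nilpotent_p_brace circ p n k \<gamma>
    using assms(1,3,6-9) zsmul_card_UNIV[OF assms(4)]
    by unfold_locales (simp_all add: nilpotency_index_def assms(5))
  show ?thesis
    by (simp add: flowOmega_eq_log_vec[OF assms(4)] expL_log_vec circ_eq)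
qed

end
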